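(* Let $b(0)=1$ and $b(2m-1)=b(2m)=(-1)^m\binom{2m}{m}$ for $m\ge1$, so that $(b(n))_{n\ge0}=(1,-2,-2,6,6,-20,-20,\dots)$. Let $(\bar b(n))_{n\ge 0}=(b(0),0,b(1),0,b(2),0,\dots)$, i.e. $\bar b(2n)=b(n)$ and $\bar b(2n+1)=0$ for $n\ge 0$. Set $\bar D_0(n)=\det(\bar b(i+j))_{i,j=0}^{n-1}$ and $\bar D_1(n)=\det(\bar b(i+j+1))_{i,j=0}^{n-1}$. Then for all integers $n\ge 0$ $$\bar D_0(4n)=2^{4n-1}L_{2n}L_{2n+1},\quad \bar D_0(4n+1)=2^{4n}L_{2n+1}^2,$$ $$\bar D_0(4n+2)=-2^{4n+1}L_{2n+1}^2,\quad \bar D_0(4n+3)=2^{4n+2}L_{2n+1}L_{2n+2},$$ and $$\bar D_1(2n+1)=0,\quad \bar D_1(4n)=2^{4n}L_{2n+1}^2,\quad \bar D_1(4n+2)=-2^{4n+2}L_{2n+1}^2.$$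
   Context: $L_n$ is the Lucas sequence $L_0=2$, $L_1=1$, $L_n=L_{n-1}+L_{n-2}$. The determinant of the empty ($0\times 0$) matrix is $1$. *)

theory Defs
  imports Jordan_Normal_Form.Determinant
begin

fun lucas :: "nat \<Rightarrow> int" where
  "lucas 0 = 2"
| "lucas (Suc 0) = 1"
| "lucas (Suc (Suc n)) = lucas (Suc n) + lucas n"

text \<open>For \<open>n = 2m - 1\<close> and for \<open>n = 2m\<close> one has \<open>(n + 1) div 2 = m\<close>; the lemmas
  below recover the defining equations for \<open>m \<ge> 1\<close>.\<close>

definition b :: "nat \<Rightarrow> int" where
  "b n = (let m = (n + 1) div 2 in (-1) ^ m * int ((2 * m) choose m))"

lemma b_0: "b 0 = 1"
  by (simp add: b_def)

lemma b_odd: "m \<ge> 1 \<Longrightarrow> b (2 * m - 1) = (-1) ^ m * int ((2 * m) choose m)"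
  by (simp add: b_def)

lemma b_even: "m \<ge> 1 \<Longrightarrow> b (2 * m) = (-1) ^ m * int ((2 * m) choose m)"
  by (simp add: b_def)

definition bbar :: "nat \<Rightarrow> int" where
  "bbar n = (if even n then b (n div 2) else 0)"

definition Dbar :: "nat \<Rightarrow> nat \<Rightarrow> int" where
  "Dbar k n = det (mat n n (\<lambda>(i, j). bbar (i + j + k)))"

end

theory Submission
  imports Defs
begin

text \<open>The constant terms \<open>a(n)\<close> of \<open>(z - 1/z)\<^sup>n\<close> are the moments of a functional \<open>\<Lambda>\<close> for which the Lucas
  polynomials \<open>\<ell>\<^sub>0 = 2\<close>, \<open>\<ell>\<^sub>1 = x\<close>, \<open>\<ell>\<^sub>i\<^sub>+\<^sub>2 = x \<ell>\<^sub>i\<^sub>+\<^sub>1 + \<ell>\<^sub>i\<close> are orthogonal. Since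
  \<open>b(n) = a(n) + a(n + 1)\<close>, the functional with moments \<open>b(n)\<close> is \<open>p \<mapsto> \<Lambda>((x + 1) p)\<close>, so Christoffel's
  formula yields its orthogonal polynomials \<open>q\<^sub>i = (\<ell>\<^sub>i\<^sub>+\<^sub>1 + c \<ell>\<^sub>i) / (x + 1)\<close>, and those for the
  moments \<open>b(n + 1)\<close>, \<open>r\<^sub>i = (\<ell>\<^sub>i\<^sub>+\<^sub>2 + c \<ell>\<^sub>i\<^sub>+\<^sub>1 + d \<ell>\<^sub>i) / (x (x + 1))\<close>. The constants are fixed by
  divisibility, and Lucas numbers enter as \<open>\<ell>\<^sub>i(-1) = (-1)\<^sup>i L\<^sub>i\<close>. For the interleaved moments, \<open>q\<^sub>i(x\<^sup>2)\<close>
  and \<open>x r\<^sub>i(x\<^sup>2)\<close> are orthogonal; the first Hankel determinant is the product of their norms, and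
  the shifted one is its multiple by \<open>(-1)\<^sup>n\<close> times the value of the \<open>n\<close>-th polynomial at \<open>0\<close>.\<close>

section \<open>Hankel determinants and orthogonal polynomials\<close>

text \<open>The moments stay an explicit argument because multiplying \<open>p\<close> by x^j
  amounts to shifting \<open>h\<close> by \<open>j\<close>; orthogonality to x^j is thus expressed
  through \<open>\<lambda>k. h (k + j)\<close>.\<close>

definition moment_functional :: "(nat \<Rightarrow> 'a) \<Rightarrow> 'a::comm_ring_1 poly \<Rightarrow> 'a" where
  "moment_functional h p = (\<Sum>k\<le>degree p. coeff p k * h k)"

lemma moment_functional_eq_sum:
  assumes "degree p < n"
  shows "moment_functional h p = (\<Sum>k<n. coeff p k * h k)"
  unfolding moment_functional_def using assms
  by (intro sum.mono_neutral_left) (auto simp: coeff_eq_0)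

lemma moment_functional_0 [simp]: "moment_functional h 0 = 0"
  by (simp add: moment_functional_def)

lemma moment_functional_zero [simp]: "moment_functional (\<lambda>k. 0) p = 0"
  by (simp add: moment_functional_def)

lemma moment_functional_pCons [simp]:
  "moment_functional h (pCons c p) = c * h 0 + moment_functional (\<lambda>k. h (Suc k)) p"
proof -
  have "moment_functional h (pCons c p) = (\<Sum>k<Suc (Suc (degree p)). coeff (pCons c p) k * h k)"
    by (rule moment_functional_eq_sum) (auto simp: degree_pCons_eq_if)
  also have "\<dots> = c * h 0 + moment_functional (\<lambda>k. h (Suc k)) p"
    by (subst sum.lessThan_Suc_shift) (simp add: moment_functional_eq_sum[of p "Suc (degree p)"])
  finally show ?thesis .
qed

lemma moment_functional_add:
  "moment_functional h (p + q) = moment_functional h p + moment_functional h q"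
  by (induction p q arbitrary: h rule: poly_induct2) (simp_all add: algebra_simps)

lemma moment_functional_smult:
  "moment_functional h (smult c p) = c * moment_functional h p"
  by (induction p arbitrary: h) (simp_all add: algebra_simps)

lemma moment_functional_minus: "moment_functional h (- p) = - moment_functional h p"
  using moment_functional_smult[of h "-1" p] by simp

lemma moment_functional_add_moments:
  "moment_functional (\<lambda>k. g k + h k) p = moment_functional g p + moment_functional h p"
  by (simp add: moment_functional_def sum.distrib algebra_simps)

lemma moment_functional_pcompose_square:
  "moment_functional h (pcompose p [:0, 0, 1:]) = moment_functional (\<lambda>k. h (2 * k)) p"
  by (induction p arbitrary: h) (simp_all add: pcompose_pCons moment_functional_add)

text \<open>Multiplying the Hankel matrix on the left by the unitriangular matrix of coefficients of
  the \<open>Q i\<close> gives the pairings of \<open>Q i\<close> with x^j. By orthogonality that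
  product is upper triangular, with the norms on its diagonal.\<close>

lemma det_hankel_orthogonal:
  fixes h :: "nat \<Rightarrow> 'a::idom"
  assumes deg: "\<And>i. i < n \<Longrightarrow> degree (Q i) = i"
    and monic: "\<And>i. i < n \<Longrightarrow> lead_coeff (Q i) = 1"
    and orth: "\<And>i j. i < n \<Longrightarrow> j < i \<Longrightarrow> moment_functional (\<lambda>k. h (k + j)) (Q i) = 0"
  shows "det (mat n n (\<lambda>(i, j). h (i + j)))
           = (\<Prod>i<n. moment_functional (\<lambda>k. h (k + i)) (Q i))"
proof -
  define H where "H = mat n n (\<lambda>(i, j). h (i + j))"
  define C where "C = mat n n (\<lambda>(i, k). coeff (Q i) k)"
  define U where "U = mat n n (\<lambda>(i, j). moment_functional (\<lambda>k. h (k + j)) (Q i))"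
  have [simp]: "H \<in> carrier_mat n n" "C \<in> carrier_mat n n" "U \<in> carrier_mat n n"
    by (simp_all add: H_def C_def U_def)
  have "C * H = U"
    by (rule eq_matI)
      (simp_all add: C_def H_def U_def scalar_prod_def moment_functional_eq_sum[of _ n] deg
        lessThan_atLeast0)
  moreover have "det C = 1"
  proof -
    have "det C = prod_list (diag_mat C)"
      by (rule det_lower_triangular[of n]) (auto simp: C_def deg coeff_eq_0)
    also have "diag_mat C = replicate n 1"
      by (rule nth_equalityI) (use deg monic in \<open>auto simp: diag_mat_def C_def\<close>)
    finally show ?thesis by simp
  qed
  moreover have "det U = (\<Prod>i<n. moment_functional (\<lambda>k. h (k + i)) (Q i))"
  proof -
    have "det U = prod_list (diag_mat U)"
      by (rule det_upper_triangular[of _ n]) (auto simp: U_def orth upper_triangular_def)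
    also have "\<dots> = (\<Prod>i<n. moment_functional (\<lambda>k. h (k + i)) (Q i))"
      by (simp add: prod_list_diag_prod U_def lessThan_atLeast0)
    finally show ?thesis .
  qed
  ultimately show ?thesis
    using det_mult[of C n H] by (simp add: H_def)
qed

lemma det_companion:
  fixes c :: "nat \<Rightarrow> 'a::comm_ring_1"
  shows "det (mat (Suc n) (Suc n) (\<lambda>(i, j). if j < n then if i = Suc j then 1 else 0 else - c i))
           = (- 1) ^ Suc n * c 0"
    (is "det ?M = _")
proof -
  \<comment> \<open>The first row is zero except in its last column, so only this minor
    matters.\<close>
  have minor: "mat_delete ?M 0 n = 1\<^sub>m n"
    by (rule eq_matI) (auto simp: mat_delete_def)
  have "det ?M = (\<Sum>j<Suc n. ?M $$ (0, j) * cofactor ?M 0 j)"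
    by (rule laplace_expansion_row) auto
  also have "\<dots> = - c 0 * cofactor ?M 0 n"
    by simp
  finally show ?thesis
    by (simp add: cofactor_def minor)
qed

text \<open>Shifting the Hankel matrix by one is multiplication by the companion matrix of the orthogonal
  polynomial \<open>p\<close>.\<close>

lemma det_hankel_shift:
  fixes h :: "nat \<Rightarrow> 'a::idom"
  assumes deg: "degree p = n" and monic: "lead_coeff p = 1"
    and orth: "\<And>j. j < n \<Longrightarrow> moment_functional (\<lambda>k. h (k + j)) p = 0"
  shows "det (mat n n (\<lambda>(i, j). h (i + j + 1)))
           = (- 1) ^ n * poly p 0 * det (mat n n (\<lambda>(i, j). h (i + j)))"
proof (cases n)
  case 0
  with deg monic have "p = 1"
    by (metis degree_0_id lead_coeff_pCons(2) of_int_hom.hom_one one_pCons)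
  then show ?thesis by (simp add: 0 det_dim_zero)
next
  case (Suc m)
  let ?M = "mat n n (\<lambda>(i, j). if j < m then if i = Suc j then 1 else 0 else - coeff p i)"
  have shift: "mat n n (\<lambda>(i, j). h (i + j)) * ?M = mat n n (\<lambda>(i, j). h (i + j + 1))"
  proof (rule eq_matI)
    fix i j assume "i < dim_row (mat n n (\<lambda>(i, j). h (i + j + 1)))"
      "j < dim_col (mat n n (\<lambda>(i, j). h (i + j + 1)))"
    then have ij: "i < n" "j < n" by auto
    have "(\<Sum>k<n. h (i + k) * (if j < m then if k = Suc j then 1 else 0 else - coeff p k)) = h (i + j + 1)"
    proof (cases "j < m")
      case True
      then have "Suc j < n" using Suc by simp
      then show ?thesis using True by (simp add: if_distrib[of "(*) _"] cong: if_cong)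
    next
      case False
      with ij Suc have j: "j = m" by simp
      \<comment> \<open>Orthogonality of \<open>p\<close> to x^i expresses the moment
        \<open>h (n + i)\<close> through the \<open>n\<close> moments before it; this is the last
        column of the product.\<close>
      have "0 = (\<Sum>k<Suc n. coeff p k * h (k + i))"
        using orth[OF ij(1)] deg by (simp add: moment_functional_eq_sum[of p "Suc n"])
      also have "\<dots> = (\<Sum>k<n. coeff p k * h (k + i)) + h (n + i)"
        using monic deg by simp
      finally show ?thesis using j Suc
        by (simp add: sum_negf algebra_simps add_eq_0_iff)
    qed
    then show "(mat n n (\<lambda>(i, j). h (i + j)) * ?M) $$ (i, j) = mat n n (\<lambda>(i, j). h (i + j + 1)) $$ (i, j)"
      using ij by (simp add: scalar_prod_def lessThan_atLeast0)
  qed auto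
  have "det ?M = (- 1) ^ n * poly p 0"
    unfolding Suc by (subst det_companion) (simp add: poly_0_coeff_0)
  then show ?thesis
    using det_mult[of "mat n n (\<lambda>(i, j). h (i + j))" n ?M] shift by simp
qed

section \<open>Lucas polynomials\<close>

fun lucas_poly :: "nat \<Rightarrow> rat poly" where
  "lucas_poly 0 = [:2:]"
| "lucas_poly (Suc 0) = [:0, 1:]"
| "lucas_poly (Suc (Suc n)) = pCons 0 (lucas_poly (Suc n)) + lucas_poly n"

lemma degree_lucas_poly: "degree (lucas_poly n) = n"
proof (induction n rule: lucas_poly.induct)
  case (3 n)
  have "degree (pCons 0 (lucas_poly (Suc n))) = Suc (Suc n)"
    using 3 by (subst degree_pCons_eq) auto
  then show ?case using 3 by (simp add: degree_add_eq_left)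
qed auto

lemma lead_coeff_lucas_poly: "n > 0 \<Longrightarrow> coeff (lucas_poly n) n = 1"
proof (induction n rule: lucas_poly.induct)
  case (3 n)
  then show ?case by (simp add: coeff_eq_0 degree_lucas_poly)
qed auto

lemma poly_lucas_poly_minus1: "poly (lucas_poly n) (-1) = (-1) ^ n * of_int (lucas n)"
  by (induction n rule: lucas_poly.induct) (simp_all add: algebra_simps)

lemma poly_lucas_poly_0: "poly (lucas_poly n) 0 = (if even n then 2 else 0)"
  by (induction n rule: lucas_poly.induct) auto

lemma lucas_pos: "lucas n > 0"
  by (induction n rule: lucas.induct) auto

text \<open>The constant term of \<open>(z - 1/z)\<^sup>n\<close>. With \<open>x = z - 1/z\<close> the Lucas polynomial becomes
  \<open>z\<^sup>i + (-1/z)\<^sup>i\<close>, which explains the moments below.\<close>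

definition central :: "nat \<Rightarrow> rat" where
  "central n = (if even n then (-1) ^ (n div 2) * of_nat (n choose (n div 2)) else 0)"

text \<open>This is the constant term of (z - 1/z)^j (z^i + (-1/z)^i). The symmetry z -> -1/z makes
  both summands contribute equally, hence the factor 2, and the binomial theorem gives the
  rest.\<close>

lemma moment_lucas_poly:
  "moment_functional (\<lambda>k. central (k + j)) (lucas_poly i)
     = (if i \<le> j \<and> even (i + j) then 2 * (-1) ^ ((i + j) div 2) * of_nat (j choose ((j - i) div 2)) else 0)"
proof (induction i arbitrary: j rule: lucas_poly.induct)
  case 1
  show ?case by (simp add: central_def)
next
  case 2
  show ?case
  proof (cases "even j")
    case True
    then show ?thesis by (simp add: central_def)
  next
    case False
    then obtain k where k: "j = 2 * k + 1" by (rule oddE)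
    have "(2 * k + 2) choose (k + 1) = 2 * ((2 * k + 1) choose k)"
      using binomial_symmetric[of k "2 * k + 1"] by simp
    then show ?thesis by (simp add: central_def k)
  qed
next
  case (3 i)
  have step: "moment_functional (\<lambda>k. central (k + j)) (lucas_poly (Suc (Suc i)))
    = moment_functional (\<lambda>k. central (k + Suc j)) (lucas_poly (Suc i))
      + moment_functional (\<lambda>k. central (k + j)) (lucas_poly i)"
    by (simp add: moment_functional_add)
  \<comment> \<open>In the first two cases both terms of \<open>step\<close> vanish, for
    \<open>j = i\<close> they cancel, and in the last case Pascal's rule combines them.\<close>
  consider "odd (i + j)" | "even (i + j)" "j < i" | "j = i" | k where "j = i + 2 + 2 * k"
  proof -
    have "\<exists>k. j = i + 2 + 2 * k" if "even (i + j)" "i < j"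
    proof -
      from that have "even (j - i)" by simp
      then obtain k where "j - i = 2 * k" by (rule evenE)
      with that have "j = i + 2 + 2 * (k - 1)" by (cases k) auto
      then show ?thesis ..
    qed
    then show ?thesis using that by (meson nat_neq_iff)
  qed
  then show ?case
  proof cases
    case 4
    have e: "(i + (i + 2 + 2 * k)) div 2 = i + k + 1"
      "(Suc i + Suc (i + 2 + 2 * k)) div 2 = i + k + 2"
      "(Suc (Suc i) + (i + 2 + 2 * k)) div 2 = i + k + 2"
      "(i + 2 + 2 * k - i) div 2 = Suc k"
      "(Suc (i + 2 + 2 * k) - Suc i) div 2 = Suc k"
      "(i + 2 + 2 * k - Suc (Suc i)) div 2 = k"
      by simp_all
    show ?thesis
      using step unfolding 4 3 e by (simp add: algebra_simps del: lucas_poly.simps)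
  qed (unfold step 3, auto)
qed

section \<open>Orthogonal polynomials for the moments\<close>

lemma of_int_b: "of_int (b n) = central n + central (Suc n)"
proof (cases "even n")
  case True
  then show ?thesis by (auto simp: b_def central_def Let_def elim!: evenE)
next
  case False
  then obtain m where "n = 2 * m + 1" by (rule oddE)
  then show ?thesis by (simp add: b_def central_def Let_def)
qed

lemma moment_functional_b:
  "moment_functional (\<lambda>k. of_int (b (k + l))) p
     = moment_functional (\<lambda>k. central (k + l)) ([:1, 1:] * p)"
  by (simp add: of_int_b moment_functional_add moment_functional_add_moments)

lemma linear_factor_monic:
  fixes p q :: "'a::idom poly"
  assumes "[:c, 1:] * q = p" "degree p = Suc n" "lead_coeff p = 1"
  shows "degree q = n \<and> lead_coeff q = 1"
proof -
  have "q \<noteq> 0" using assms by auto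
  then have "degree p = Suc (degree q)"
    unfolding assms(1)[symmetric] by (subst degree_mult_eq) auto
  moreover have "lead_coeff p = lead_coeff q"
    unfolding assms(1)[symmetric] lead_coeff_mult by simp
  ultimately show ?thesis using assms by simp
qed

lemma monic_add_lower:
  assumes "degree p = n" "lead_coeff p = 1" "degree q < n"
  shows "degree (p + q) = n \<and> lead_coeff (p + q) = 1"
  using assms by (auto simp: degree_add_eq_left coeff_eq_0)

text \<open>The coefficient is minus the quotient of the values of the two Lucas polynomials at -1,
  which makes the sum vanish there.\<close>

definition q_num :: "nat \<Rightarrow> rat poly" where
  "q_num i = lucas_poly (Suc i) + smult (of_int (lucas (Suc i)) / of_int (lucas i)) (lucas_poly i)"

definition q_poly :: "nat \<Rightarrow> rat poly" where
  "q_poly i = q_num i div [:1, 1:]"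

lemma q_num_eq: "q_num i = [:1, 1:] * q_poly i"
proof -
  have "poly (q_num i) (-1) = 0"
    using lucas_pos[of i] by (simp add: q_num_def poly_lucas_poly_minus1)
  then have "[:1, 1:] dvd q_num i"
    by (simp add: poly_eq_0_iff_dvd)
  then show ?thesis unfolding q_poly_def by (rule dvd_mult_div_cancel[symmetric])
qed

lemma q_poly_monic: "degree (q_poly i) = i \<and> lead_coeff (q_poly i) = 1"
proof -
  have "degree (smult (of_int (lucas (Suc i)) / of_int (lucas i)) (lucas_poly i)) < Suc i"
    using degree_smult_le[of _ "lucas_poly i"] by (simp add: degree_lucas_poly le_less_trans less_Suc_eq_le)
  then have "degree (q_num i) = Suc i \<and> lead_coeff (q_num i) = 1"
    unfolding q_num_def
    by (intro monic_add_lower) (simp_all add: degree_lucas_poly lead_coeff_lucas_poly)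
  then show ?thesis
    using linear_factor_monic[OF q_num_eq[symmetric]] by blast
qed

text \<open>The combination must vanish at 0 and at -1. For even \<open>i\<close> the root 0 forces
  d = -1, and the root -1 then gives c = 1 by the Lucas recurrence. For odd \<open>i\<close> the
  root 0 forces c = 0, and the root -1 determines d.\<close>

definition r_num :: "nat \<Rightarrow> rat poly" where
  "r_num i = lucas_poly (Suc (Suc i)) +
     (if even i then lucas_poly (Suc i) - lucas_poly i
      else - smult (of_int (lucas (Suc (Suc i))) / of_int (lucas i)) (lucas_poly i))"

definition r_poly :: "nat \<Rightarrow> rat poly" where
  "r_poly i = r_num i div ([:0, 1:] * [:1, 1:])"

lemma r_num_eq: "r_num i = [:0, 1:] * ([:1, 1:] * r_poly i)"
proof -
  have "poly (r_num i) 0 = 0"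
    by (simp add: r_num_def poly_lucas_poly_0 del: lucas_poly.simps(3))
  then obtain s where s: "r_num i = [:0, 1:] * s"
    by (auto simp: poly_eq_0_iff_dvd elim!: dvdE)
  have "poly (r_num i) (-1) = 0"
    using lucas_pos[of i]
    by (simp add: r_num_def poly_lucas_poly_minus1 del: lucas_poly.simps(3))
  then have "poly s (-1) = 0"
    by (simp add: s)
  then obtain t where t: "s = [:1, 1:] * t"
    by (auto simp: poly_eq_0_iff_dvd elim!: dvdE)
  have "[:0, 1:] * [:1, 1:] dvd r_num i"
    unfolding s t by (metis dvd_triv_left mult.assoc)
  then have "[:0, 1:] * [:1, 1:] * r_poly i = r_num i"
    unfolding r_poly_def by (rule dvd_mult_div_cancel)
  then show ?thesis by (simp only: mult.assoc)
qed

lemma r_poly_monic: "degree (r_poly i) = i \<and> lead_coeff (r_poly i) = 1"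
proof -
  have "degree (r_num i) = Suc (Suc i) \<and> lead_coeff (r_num i) = 1"
    unfolding r_num_def
    by (intro monic_add_lower)
      (auto simp: degree_lucas_poly lead_coeff_lucas_poly less_Suc_eq_le
        intro!: degree_diff_le order.trans[OF degree_smult_le] simp del: lucas_poly.simps(3))
  then have "degree ([:1, 1:] * r_poly i) = Suc i \<and> lead_coeff ([:1, 1:] * r_poly i) = 1"
    using linear_factor_monic[OF r_num_eq[symmetric]] by blast
  then show ?thesis
    using linear_factor_monic[OF refl] by blast
qed

section \<open>Orthogonal polynomials and norms for the interleaved moments\<close>

definition bbar_poly :: "nat \<Rightarrow> rat poly" where
  "bbar_poly k = (if even k then pcompose (q_poly (k div 2)) [:0, 0, 1:]
     else pCons 0 (pcompose (r_poly (k div 2)) [:0, 0, 1:]))"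

text \<open>On the diagonal only the summand \<open>lucas_poly i\<close> of the numerator has a
  nonzero moment, so the norm is \<open>2 * (-1) ^ i\<close> times its coefficient in
  \<open>q_num i\<close> or \<open>r_num i\<close>.\<close>

definition bbar_norm :: "nat \<Rightarrow> rat" where
  "bbar_norm k = (let i = k div 2 in
     if even k then 2 * (-1) ^ i * of_int (lucas (i + 1)) / of_int (lucas i)
     else if even i then - 2
     else 2 * of_int (lucas (i + 2)) / of_int (lucas i))"

lemma pcompose_square_monic:
  fixes p :: "'a::idom poly"
  assumes "degree p = n \<and> lead_coeff p = 1"
  shows "degree (pcompose p [:0, 0, 1:]) = 2 * n \<and> lead_coeff (pcompose p [:0, 0, 1:]) = 1"
proof
  show "degree (pcompose p [:0, 0, 1:]) = 2 * n"
    using assms by (simp add: degree_pcompose)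
  show "lead_coeff (pcompose p [:0, 0, 1:]) = 1"
    using assms by (subst lead_coeff_comp) auto
qed

lemma bbar_poly_monic: "degree (bbar_poly k) = k" "coeff (bbar_poly k) k = 1"
proof -
  have "degree (bbar_poly k) = k \<and> lead_coeff (bbar_poly k) = 1"
  proof (cases "even k")
    case True
    then show ?thesis
      using pcompose_square_monic[OF q_poly_monic[of "k div 2"]]
      by (auto simp: bbar_poly_def)
  next
    case False
    define p where "p = pcompose (r_poly (k div 2)) [:0, 0, 1:]"
    have p: "degree p = 2 * (k div 2) \<and> lead_coeff p = 1"
      unfolding p_def by (rule pcompose_square_monic[OF r_poly_monic])
    then have "p \<noteq> 0" by auto
    with p False show ?thesis
      by (auto simp: bbar_poly_def coeff_pCons odd_pos split: nat.split simp flip: p_def)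
  qed
  then show "degree (bbar_poly k) = k" "coeff (bbar_poly k) k = 1" by auto
qed

lemma moment_q_poly:
  "moment_functional (\<lambda>m. of_int (b (m + l))) (q_poly i)
     = moment_functional (\<lambda>m. central (m + l)) (lucas_poly (Suc i))
       + of_int (lucas (Suc i)) / of_int (lucas i)
         * moment_functional (\<lambda>m. central (m + l)) (lucas_poly i)"
  unfolding moment_functional_b q_num_eq[symmetric]
  by (simp add: q_num_def moment_functional_add moment_functional_smult)

text \<open>The shift in \<open>Suc l\<close> supplies the factor x and the passage from
  \<open>b\<close> to \<open>central\<close> the factor x + 1, which together clear the denominator
  of \<open>r_poly\<close>.\<close>

lemma moment_r_poly:
  "moment_functional (\<lambda>m. of_int (b (m + Suc l))) (r_poly i)
     = moment_functional (\<lambda>m. central (m + l)) (lucas_poly (Suc (Suc i))) +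
     (if even i
      then moment_functional (\<lambda>m. central (m + l)) (lucas_poly (Suc i))
        - moment_functional (\<lambda>m. central (m + l)) (lucas_poly i)
      else - (of_int (lucas (Suc (Suc i))) / of_int (lucas i)
         * moment_functional (\<lambda>m. central (m + l)) (lucas_poly i)))"
proof -
  have "moment_functional (\<lambda>m. of_int (b (m + Suc l))) (r_poly i)
    = moment_functional (\<lambda>m. central (m + l)) ([:0, 1:] * ([:1, 1:] * r_poly i))"
    by (subst moment_functional_b) simp
  then show ?thesis
    unfolding r_num_eq[symmetric] r_num_def
    by (simp add: moment_functional_add moment_functional_smult moment_functional_minus
        diff_conv_add_uminus del: lucas_poly.simps lucas.simps add_uminus_conv_diff)
qed

text \<open>If \<open>j\<close> and \<open>k\<close> differ in parity, only odd-indexed values of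
  \<open>bbar\<close> occur. Otherwise the claim reduces to \<open>q_poly\<close> or
  \<open>r_poly\<close>, and for \<open>j < k\<close> all Lucas polynomials in the numerator have
  index above the power paired with them.\<close>

lemma moment_bbar_poly:
  assumes "j \<le> k"
  shows "moment_functional (\<lambda>m. of_int (bbar (m + j))) (bbar_poly k)
           = (if j = k then bbar_norm k else 0)"
proof (cases "even k")
  case True
  then obtain i where k: "k = 2 * i" by (rule evenE)
  show ?thesis
  proof (cases "even j")
    case even: True
    then obtain l where j: "j = 2 * l" by (rule evenE)
    have eq: "moment_functional (\<lambda>m. of_int (bbar (m + j))) (bbar_poly k)
      = moment_functional (\<lambda>m. of_int (b (m + l))) (q_poly i)"
      by (simp add: k j bbar_poly_def moment_functional_pcompose_square bbar_def)
    then show ?thesis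
      using assms unfolding eq moment_q_poly moment_lucas_poly
      by (auto simp: k j bbar_norm_def simp del: lucas_poly.simps)
  next
    case False
    then show ?thesis
      using k by (auto simp: bbar_poly_def moment_functional_pcompose_square bbar_def)
  qed
next
  case False
  then obtain i where k: "k = 2 * i + 1" by (rule oddE)
  show ?thesis
  proof (cases "even j")
    case True
    then show ?thesis
      using k by (auto simp: bbar_poly_def moment_functional_pcompose_square bbar_def)
  next
    case False
    then obtain l where j: "j = 2 * l + 1" by (rule oddE)
    have eq: "moment_functional (\<lambda>m. of_int (bbar (m + j))) (bbar_poly k)
      = moment_functional (\<lambda>m. of_int (b (m + Suc l))) (r_poly i)"
      by (simp add: k j bbar_poly_def moment_functional_pcompose_square bbar_def)
    then show ?thesis
      using assms unfolding eq moment_r_poly moment_lucas_poly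
      by (auto simp: k j bbar_norm_def simp del: lucas_poly.simps lucas.simps)
  qed
qed

section \<open>The determinants\<close>

lemma of_int_Dbar:
  "of_int (Dbar k n) = det (mat n n (\<lambda>(i, j). rat_of_int (bbar (i + j + k))))"
  unfolding Dbar_def of_int_hom.hom_det[symmetric]
  by (intro arg_cong[of _ _ det] eq_matI) auto

lemma Dbar_0_eq_prod: "of_int (Dbar 0 n) = (\<Prod>k<n. bbar_norm k)"
proof -
  have "of_int (Dbar 0 n)
    = (\<Prod>k<n. moment_functional (\<lambda>m. rat_of_int (bbar (m + k))) (bbar_poly k))"
    unfolding of_int_Dbar add_0_right
    by (rule det_hankel_orthogonal) (simp_all add: bbar_poly_monic moment_bbar_poly)
  then show ?thesis by (simp add: moment_bbar_poly)
qed

lemma Dbar_1_eq: "rat_of_int (Dbar 1 n) = (- 1) ^ n * poly (bbar_poly n) 0 * of_int (Dbar 0 n)"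
  unfolding of_int_Dbar add_0_right
  by (rule det_hankel_shift) (simp_all add: bbar_poly_monic moment_bbar_poly)

text \<open>The factor x + 1 equals 1 at 0, so the numerator can be evaluated instead.\<close>

lemma poly_bbar_poly_0:
  "poly (bbar_poly (2 * i)) 0 = (if even i then 2 * of_int (lucas (i + 1)) / of_int (lucas i) else 2)"
proof -
  have "poly (bbar_poly (2 * i)) 0 = poly (q_num i) 0"
    by (simp add: bbar_poly_def poly_pcompose q_num_eq)
  then show ?thesis
    by (simp add: q_num_def poly_lucas_poly_0 del: lucas_poly.simps)
qed

text \<open>The signs and shapes of the norms repeat with period 4, so the four formulas are proved
  in a cycle: each follows from the one before by one more norm, whose denominator cancels a Lucas
  factor or is absent.\<close>

lemma Dbar_0_values:
  "(of_int (Dbar 0 (4 * n)) :: rat) = 2 ^ (4 * n) / 2 * of_int (lucas (2 * n)) * of_int (lucas (2 * n + 1))"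
  "(of_int (Dbar 0 (4 * n + 1)) :: rat) = 2 ^ (4 * n) * (of_int (lucas (2 * n + 1)))\<^sup>2"
  "(of_int (Dbar 0 (4 * n + 2)) :: rat) = - (2 ^ (4 * n + 1) * (of_int (lucas (2 * n + 1)))\<^sup>2)"
  "(of_int (Dbar 0 (4 * n + 3)) :: rat)
     = 2 ^ (4 * n + 2) * of_int (lucas (2 * n + 1)) * of_int (lucas (2 * n + 2))"
proof -
  have Suc: "rat_of_int (Dbar 0 (Suc m)) = of_int (Dbar 0 m) * bbar_norm m" for m
    by (simp add: Dbar_0_eq_prod)
  have pos: "rat_of_int (lucas m) \<noteq> 0" for m
    using lucas_pos[of m] by simp
  have div: "(4 * n) div 2 = 2 * n" "(4 * n + 1) div 2 = 2 * n" "(4 * n + 2) div 2 = 2 * n + 1"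
    "(4 * n + 3) div 2 = 2 * n + 1" for n :: nat
    by simp_all
  have norm: "bbar_norm (4 * n) = 2 * of_int (lucas (2 * n + 1)) / of_int (lucas (2 * n))"
    "bbar_norm (4 * n + 1) = - 2"
    "bbar_norm (4 * n + 2) = - 2 * of_int (lucas (2 * n + 2)) / of_int (lucas (2 * n + 1))"
    "bbar_norm (4 * n + 3) = 2 * of_int (lucas (2 * n + 3)) / of_int (lucas (2 * n + 1))" for n
    by (simp_all add: bbar_norm_def Let_def div numeral_3_eq_3 del: lucas.simps)
  have step1: "rat_of_int (Dbar 0 (4 * n + 1)) = 2 ^ (4 * n) * (of_int (lucas (2 * n + 1)))\<^sup>2"
    if "rat_of_int (Dbar 0 (4 * n)) = 2 ^ (4 * n) / 2 * of_int (lucas (2 * n)) * of_int (lucas (2 * n + 1))"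
    for n
    using Suc[of "4 * n"] that norm(1)[of n] pos[of "2 * n"]
    by (simp add: power2_eq_square del: lucas.simps)
  have step2: "rat_of_int (Dbar 0 (4 * n + 2)) = - (2 ^ (4 * n + 1) * (of_int (lucas (2 * n + 1)))\<^sup>2)"
    if "rat_of_int (Dbar 0 (4 * n + 1)) = 2 ^ (4 * n) * (of_int (lucas (2 * n + 1)))\<^sup>2" for n
    using Suc[of "4 * n + 1"] that norm(2)[of n] by (simp del: lucas.simps)
  have step3: "rat_of_int (Dbar 0 (4 * n + 3))
    = 2 ^ (4 * n + 2) * of_int (lucas (2 * n + 1)) * of_int (lucas (2 * n + 2))"
    if "rat_of_int (Dbar 0 (4 * n + 2)) = - (2 ^ (4 * n + 1) * (of_int (lucas (2 * n + 1)))\<^sup>2)" for n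
    using Suc[of "4 * n + 2"] that norm(3)[of n] pos[of "2 * n + 1"]
    by (simp add: power2_eq_square numeral_3_eq_3 del: lucas.simps)
  have step4: "rat_of_int (Dbar 0 (4 * Suc n))
    = 2 ^ (4 * Suc n) / 2 * of_int (lucas (2 * Suc n)) * of_int (lucas (2 * Suc n + 1))"
    if "rat_of_int (Dbar 0 (4 * n + 3))
      = 2 ^ (4 * n + 2) * of_int (lucas (2 * n + 1)) * of_int (lucas (2 * n + 2))" for n
  proof -
    have eqs: "4 * Suc n = Suc (4 * n + 3)" "2 * Suc n = 2 * n + 2" "2 * Suc n + 1 = 2 * n + 3"
      by simp_all
    show ?thesis
      unfolding eqs Suc that norm using pos[of "2 * n + 1"]
      by (simp add: power_add numeral_3_eq_3 del: lucas.simps)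
  qed
  have base: "rat_of_int (Dbar 0 (4 * n))
    = 2 ^ (4 * n) / 2 * of_int (lucas (2 * n)) * of_int (lucas (2 * n + 1))" for n
  proof (induction n)
    case 0
    \<comment> \<open>The empty product is 1, and \<open>lucas 0 = 2\<close> compensates the
      division by 2.\<close>
    show ?case by (simp add: Dbar_0_eq_prod)
  next
    case (Suc n)
    then show ?case by (rule step4[OF step3[OF step2[OF step1]]])
  qed
  show "rat_of_int (Dbar 0 (4 * n))
    = 2 ^ (4 * n) / 2 * of_int (lucas (2 * n)) * of_int (lucas (2 * n + 1))"
    "(of_int (Dbar 0 (4 * n + 1)) :: rat) = 2 ^ (4 * n) * (of_int (lucas (2 * n + 1)))\<^sup>2"
    "(of_int (Dbar 0 (4 * n + 2)) :: rat) = - (2 ^ (4 * n + 1) * (of_int (lucas (2 * n + 1)))\<^sup>2)"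
    "(of_int (Dbar 0 (4 * n + 3)) :: rat)
     = 2 ^ (4 * n + 2) * of_int (lucas (2 * n + 1)) * of_int (lucas (2 * n + 2))"
    by (fact base step1[OF base] step2[OF step1[OF base]] step3[OF step2[OF step1[OF base]]])+
qed

theorem theorem2p4:
  fixes n :: nat
  shows "(of_int (Dbar 0 (4 * n)) :: rat)
           = 2 powi (4 * int n - 1) * of_int (lucas (2 * n)) * of_int (lucas (2 * n + 1))
       \<and> Dbar 0 (4 * n + 1) = 2 ^ (4 * n) * (lucas (2 * n + 1))\<^sup>2
       \<and> Dbar 0 (4 * n + 2) = - (2 ^ (4 * n + 1) * (lucas (2 * n + 1))\<^sup>2)
       \<and> Dbar 0 (4 * n + 3) = 2 ^ (4 * n + 2) * lucas (2 * n + 1) * lucas (2 * n + 2)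
       \<and> Dbar 1 (2 * n + 1) = 0
       \<and> Dbar 1 (4 * n) = 2 ^ (4 * n) * (lucas (2 * n + 1))\<^sup>2
       \<and> Dbar 1 (4 * n + 2) = - (2 ^ (4 * n + 2) * (lucas (2 * n + 1))\<^sup>2)"
proof (intro conjI)
  have "(2::rat) powi (4 * int n - 1) = 2 ^ (4 * n) / 2"
    by (simp add: power_int_diff flip: power_int_of_nat)
  then show "(of_int (Dbar 0 (4 * n)) :: rat)
    = 2 powi (4 * int n - 1) * of_int (lucas (2 * n)) * of_int (lucas (2 * n + 1))"
    by (simp only: Dbar_0_values)
  have D1: "rat_of_int (Dbar 0 (4 * n + 1)) = of_int (2 ^ (4 * n) * (lucas (2 * n + 1))\<^sup>2)"
    unfolding Dbar_0_values by simp
  then show "Dbar 0 (4 * n + 1) = 2 ^ (4 * n) * (lucas (2 * n + 1))\<^sup>2"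
    by (simp only: of_int_eq_iff)
  have D2: "rat_of_int (Dbar 0 (4 * n + 2)) = of_int (- (2 ^ (4 * n + 1) * (lucas (2 * n + 1))\<^sup>2))"
    unfolding Dbar_0_values by simp
  then show "Dbar 0 (4 * n + 2) = - (2 ^ (4 * n + 1) * (lucas (2 * n + 1))\<^sup>2)"
    by (simp only: of_int_eq_iff)
  have "rat_of_int (Dbar 0 (4 * n + 3)) = of_int (2 ^ (4 * n + 2) * lucas (2 * n + 1) * lucas (2 * n + 2))"
    unfolding Dbar_0_values by simp
  then show "Dbar 0 (4 * n + 3) = 2 ^ (4 * n + 2) * lucas (2 * n + 1) * lucas (2 * n + 2)"
    by (simp only: of_int_eq_iff)
  \<comment> \<open>The orthogonal polynomial of odd degree is x times another polynomial, hence
    zero at 0.\<close>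
  have "rat_of_int (Dbar 1 (2 * n + 1)) = 0"
    unfolding Dbar_1_eq by (simp add: bbar_poly_def)
  then show "Dbar 1 (2 * n + 1) = 0" by simp
  \<comment> \<open>The value at 0 is \<open>2 * lucas (2 * n + 1) / lucas (2 * n)\<close>; it
    removes both the factor 1/2 and \<open>lucas (2 * n)\<close>.\<close>
  have "rat_of_int (Dbar 1 (4 * n)) = of_int (2 ^ (4 * n) * (lucas (2 * n + 1))\<^sup>2)"
    unfolding Dbar_1_eq Dbar_0_values using poly_bbar_poly_0[of "2 * n"] lucas_pos[of "2 * n"]
    by (simp add: power2_eq_square del: lucas.simps)
  then show "Dbar 1 (4 * n) = 2 ^ (4 * n) * (lucas (2 * n + 1))\<^sup>2"
    by (simp only: of_int_eq_iff)
  have "rat_of_int (Dbar 1 (4 * n + 2)) = of_int (- (2 ^ (4 * n + 2) * (lucas (2 * n + 1))\<^sup>2))"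
    unfolding Dbar_1_eq Dbar_0_values using poly_bbar_poly_0[of "2 * n + 1"]
    by (simp del: lucas.simps)
  then show "Dbar 1 (4 * n + 2) = - (2 ^ (4 * n + 2) * (lucas (2 * n + 1))\<^sup>2)"
    by (simp only: of_int_eq_iff)
qed

end
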